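(* Let $\mathbb{X}$ and $\mathbb{Y}$ be Banach spaces of dimension $n$ and $m$, respectively. Let $T:\mathbb{X}\to\mathbb{Y}$ be a bounded linear operator and let $x\in\mathbb{X}$ be a $k$-smooth point of $\mathbb{X}$ such that $T$ preserves Birkhoff-James orthogonality at $x$. Then either $Tx=0$ or $Tx$ is a $p$-smooth point of $\mathbb{Y}$ for some $p$ with $k\le p$.
   Context: Banach spaces are over a common scalar field ($\mathbb{R}$ or $\mathbb{C}$). For $x,y$ in a Banach space, $x\perp_B y$ (Birkhoff-James orthogonality) means $\|x+\lambda y\|\ge\|x\|$ for all scalars $\lambda$. $T$ preserves Birkhoff-James orthogonality at $x\in\mathbb{X}$ if for every $y\in\mathbb{X}$, $x\perp_B y$ implies $Tx\perp_B Ty$. A non-zero $x\in\mathbb{X}$ is a $k$-smooth point of $\mathbb{X}$ if $\dim\operatorname{span}J(x)=k$, where $J(x)=\{f\in S_{\mathbb{X}^*}: f(x)=\|x\|\}$ and $S_{\mathbb{X}^*}$ is the unit sphere of the dual space. *)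

theory Defs
  imports "HOL-Analysis.Analysis" "HOL-Library.Function_Algebras"
begin

text \<open>
  The library has no complex normed spaces, so the scalars range over a type class whose
  members are, up to isometric isomorphism, exactly the fields \<open>\<real>\<close> and \<open>\<complex>\<close>.  In the first
  alternative the norm is the usual absolute value because of \<open>norm_of_real\<close>.
\<close>

class real_or_complex_field = real_normed_field +
  assumes real_or_complex:
    "(\<forall>z. \<exists>a::real. z = a *\<^sub>R 1) \<or>
     (\<exists>i. i * i = - 1 \<and>
       (\<forall>z. \<exists>a b::real. z = a *\<^sub>R 1 + b *\<^sub>R i \<and> norm z = sqrt (a\<^sup>2 + b\<^sup>2)))"

instance real :: real_or_complex_field
  by standard simp

instance complex :: real_or_complex_field
proof
  have "\<exists>a b::real. z = a *\<^sub>R 1 + b *\<^sub>R \<i> \<and> norm z = sqrt (a\<^sup>2 + b\<^sup>2)" for z :: complex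
    by (rule exI[of _ "Re z"], rule exI[of _ "Im z"]) (simp add: complex_eq_iff cmod_def)
  then show "(\<forall>z::complex. \<exists>a::real. z = a *\<^sub>R 1) \<or>
     (\<exists>i::complex. i * i = - 1 \<and>
       (\<forall>z. \<exists>a b::real. z = a *\<^sub>R 1 + b *\<^sub>R i \<and> norm z = sqrt (a\<^sup>2 + b\<^sup>2)))"
    by (intro disjI2 exI[of _ "\<i>"]) auto
qed

text \<open>
  A Banach space over the scalar field \<open>'k\<close>: the type class \<open>banach\<close> supplies the addition, the
  complete norm and the underlying real scalar multiplication, which \<open>scl\<close> extends.
\<close>

locale banach_space_over = vector_space scl
  for scl :: "'k::real_or_complex_field \<Rightarrow> 'a::banach \<Rightarrow> 'a" +
  assumes norm_scale: "norm (scl c x) = norm c * norm x"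
    and scale_of_real: "scl (of_real r) x = r *\<^sub>R x"

lemma banach_space_over_real: "banach_space_over (scaleR :: real \<Rightarrow> 'a::banach \<Rightarrow> 'a)"
  by unfold_locales (auto simp: algebra_simps)

lemma banach_space_over_self:
  "banach_space_over ((*) :: 'k::{real_or_complex_field,banach} \<Rightarrow> 'k \<Rightarrow> 'k)"
  by unfold_locales (auto simp: algebra_simps norm_mult scaleR_conv_of_real)

text \<open>
  \<open>vector_space.dim\<close> is also \<open>0\<close> for infinite-dimensional sets, hence the explicit
  finite spanning set.
\<close>

definition has_dimension ::
    "('k::field \<Rightarrow> 'v::ab_group_add \<Rightarrow> 'v) \<Rightarrow> 'v set \<Rightarrow> nat \<Rightarrow> bool" where
  "has_dimension scl V n \<longleftrightarrow>
     (\<exists>B. finite B \<and> V \<subseteq> module.span scl B) \<and> vector_space.dim scl V = n"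

text \<open>
  The library's \<open>bounded_linear\<close> is only real-linear; \<open>Vector_Spaces.linear\<close> adds linearity over
  \<open>'k\<close>.
\<close>

definition bounded_linear_over ::
    "('k::real_or_complex_field \<Rightarrow> 'a::real_normed_vector \<Rightarrow> 'a) \<Rightarrow>
     ('k \<Rightarrow> 'b::real_normed_vector \<Rightarrow> 'b) \<Rightarrow> ('a \<Rightarrow> 'b) \<Rightarrow> bool" where
  "bounded_linear_over scaleX scaleY T \<longleftrightarrow>
     Vector_Spaces.linear scaleX scaleY T \<and> bounded_linear T"

definition dual_space ::
    "('k::real_or_complex_field \<Rightarrow> 'a::real_normed_vector \<Rightarrow> 'a) \<Rightarrow> ('a \<Rightarrow> 'k) set" where
  "dual_space scl = {f. bounded_linear_over scl (*) f}"

text \<open>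
  Pointwise scalar multiplication of functionals; the dual space is a subspace of the space of
  all functions, so spans and dimensions may be computed in the latter.
\<close>

definition scale_fun :: "'k::field \<Rightarrow> ('a \<Rightarrow> 'k) \<Rightarrow> 'a \<Rightarrow> 'k" where
  "scale_fun c f = (\<lambda>x. c * f x)"

lemma vector_space_scale_fun: "vector_space scale_fun"
  by unfold_locales (auto simp: scale_fun_def fun_eq_iff algebra_simps)

definition support_functionals ::
    "('k::real_or_complex_field \<Rightarrow> 'a::real_normed_vector \<Rightarrow> 'a) \<Rightarrow> 'a \<Rightarrow> ('a \<Rightarrow> 'k) set" where
  "support_functionals scl x =
     {f \<in> dual_space scl. onorm f = 1 \<and> f x = of_real (norm x)}"

definition smooth_point ::
    "('k::real_or_complex_field \<Rightarrow> 'a::real_normed_vector \<Rightarrow> 'a) \<Rightarrow> nat \<Rightarrow> 'a \<Rightarrow> bool" where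
  "smooth_point scl k x \<longleftrightarrow>
     x \<noteq> 0 \<and> has_dimension scale_fun (module.span scale_fun (support_functionals scl x)) k"

definition birkhoff_james_orthogonal ::
    "('k::real_or_complex_field \<Rightarrow> 'a::real_normed_vector \<Rightarrow> 'a) \<Rightarrow> 'a \<Rightarrow> 'a \<Rightarrow> bool" where
  "birkhoff_james_orthogonal scl x y \<longleftrightarrow> (\<forall>c. norm (x + scl c y) \<ge> norm x)"

definition preserves_orthogonality_at ::
    "('k::real_or_complex_field \<Rightarrow> 'a::real_normed_vector \<Rightarrow> 'a) \<Rightarrow>
     ('k \<Rightarrow> 'b::real_normed_vector \<Rightarrow> 'b) \<Rightarrow> ('a \<Rightarrow> 'b) \<Rightarrow> 'a \<Rightarrow> bool" where
  "preserves_orthogonality_at scaleX scaleY T x \<longleftrightarrow>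
     (\<forall>y. birkhoff_james_orthogonal scaleX x y \<longrightarrow>
          birkhoff_james_orthogonal scaleY (T x) (T y))"

end

theory Submission imports Defs begin

text \<open>
  If \<open>T x \<noteq> 0\<close>, every support functional of \<open>x\<close> is, up to a scalar, the pullback along \<open>T\<close> of a
  support functional of \<open>T x\<close>.  Let \<open>f\<close> support \<open>x\<close>.  Any \<open>y\<close> in the kernel of \<open>f\<close> satisfies
  \<open>\<parallel>x\<parallel> = \<bar>f (x + c y)\<bar> \<le> \<parallel>x + c y\<parallel>\<close>, so \<open>x\<close> is orthogonal to the kernel and hence \<open>T x\<close> is orthogonal
  to the image \<open>M\<close> of the kernel under \<open>T\<close>.  As \<open>M\<close> is a subspace, orthogonality to all of its
  elements says precisely that the distance of \<open>T x\<close> from \<open>M\<close> is \<open>\<parallel>T x\<parallel>\<close>.  The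
  Hahn--Banach theorem then yields a support functional \<open>g\<close> of \<open>T x\<close> that vanishes on \<open>M\<close>
  (\<open>support_functional_vanishing_on_orthogonal_subspace\<close>).  Now \<open>g \<circ> T\<close> vanishes on the kernel of \<open>f\<close>,
  so it is a multiple of \<open>f\<close>, and a non-zero one because \<open>g (T x) = \<parallel>T x\<parallel>\<close>.

  Consequently the linear map \<open>g \<mapsto> g \<circ> T\<close> sends the span of the support functionals of \<open>T x\<close> onto a
  space that contains those of \<open>x\<close> (\<open>support_functionals_subset_pullback\<close>).  The former span is
  finite-dimensional since the codomain of \<open>T\<close> is, and a linear map does not raise dimension
  (\<open>dim_pullback_le\<close>).

  The Hahn--Banach theorem is proved for sublinear functionals on real vector spaces
  (\<open>sublinear_Hahn_Banach\<close>) and carried over to seminorms over both scalar fields by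
  complexification (\<open>seminorm_Hahn_Banach\<close>); it is applied to the seminorm that measures the
  distance from \<open>M\<close>.
\<close>

section \<open>The Hahn--Banach theorem for sublinear functionals\<close>

definition sublinear :: "('a::real_vector \<Rightarrow> real) \<Rightarrow> bool" where
  "sublinear p \<longleftrightarrow> (\<forall>y z. p (y + z) \<le> p y + p z) \<and> (\<forall>t\<ge>0. \<forall>y. p (t *\<^sub>R y) = t * p y)"

lemma sublinear_add: "sublinear p \<Longrightarrow> p (y + z) \<le> p y + p z"
  and sublinear_scaleR: "sublinear p \<Longrightarrow> 0 \<le> t \<Longrightarrow> p (t *\<^sub>R y) = t * p y"
  by (auto simp: sublinear_def)

lemma sublinear_minus:
  assumes "sublinear p"
  shows "- p (- y) \<le> p y"
proof -
  have "p (y + - y) = 0"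
    using sublinear_scaleR[OF assms, of 0 y] by simp
  then show ?thesis
    using sublinear_add[OF assms, of y "- y"] by linarith
qed

text \<open>
  The largest sublinear functional \<open>q \<le> p\<close> with \<open>q (- b) \<le> - p b\<close>: sublinearity forces
  \<open>q y \<le> q (y + t *\<^sub>R b) + t * q (- b)\<close>.  It is below \<open>p\<close> and linear along the line through \<open>b\<close>.
\<close>

definition directional_relaxation :: "('a::real_vector \<Rightarrow> real) \<Rightarrow> 'a \<Rightarrow> 'a \<Rightarrow> real" where
  "directional_relaxation p b y = (INF t\<in>{0..}. p (y + t *\<^sub>R b) - t * p b)"

context
  fixes p :: "'a::real_vector \<Rightarrow> real"
  assumes p: "sublinear p"
begin

lemma directional_relaxation_le:
  assumes "0 \<le> t"
  shows "directional_relaxation p b y \<le> p (y + t *\<^sub>R b) - t * p b"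
  unfolding directional_relaxation_def
proof (rule cINF_lower)
  have "- p (- y) \<le> p (y + s *\<^sub>R b) - s * p b" if "0 \<le> s" for s
    using sublinear_add[OF p, of "y + s *\<^sub>R b" "- y"] sublinear_scaleR[OF p that, of b] by simp
  then show "bdd_below ((\<lambda>t. p (y + t *\<^sub>R b) - t * p b) ` {0..})"
    by (intro bdd_belowI2[of _ "- p (- y)"]) simp
qed (use assms in simp)

lemma directional_relaxation_greatest:
  assumes "\<And>t. 0 \<le> t \<Longrightarrow> c \<le> p (y + t *\<^sub>R b) - t * p b"
  shows "c \<le> directional_relaxation p b y"
  unfolding directional_relaxation_def by (rule cINF_greatest) (use assms in auto)

lemma directional_relaxation_below: "directional_relaxation p b \<le> p"
  using directional_relaxation_le[of 0 b] by (simp add: le_fun_def)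

lemma directional_relaxation_uminus: "directional_relaxation p b (- b) \<le> - p b"
  using directional_relaxation_le[of 1 b "- b"] sublinear_scaleR[OF p, of 0 b] by simp

lemma sublinear_directional_relaxation: "sublinear (directional_relaxation p b)"
proof -
  let ?q = "directional_relaxation p b"
  have add: "?q (y + z) \<le> ?q y + ?q z" for y z
  proof -
    have "?q (y + z) - (p (z + t *\<^sub>R b) - t * p b) \<le> p (y + s *\<^sub>R b) - s * p b"
      if "0 \<le> s" "0 \<le> t" for s t
      using directional_relaxation_le[of "s + t" b "y + z"] that
        sublinear_add[OF p, of "y + s *\<^sub>R b" "z + t *\<^sub>R b"]
      by (simp add: algebra_simps)
    then have "?q (y + z) - (p (z + t *\<^sub>R b) - t * p b) \<le> ?q y" if "0 \<le> t" for t
      using that by (intro directional_relaxation_greatest) simp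
    then have "?q (y + z) - ?q y \<le> p (z + t *\<^sub>R b) - t * p b" if "0 \<le> t" for t
      using that by (simp add: algebra_simps)
    then have "?q (y + z) - ?q y \<le> ?q z"
      by (rule directional_relaxation_greatest)
    then show ?thesis by simp
  qed
  have le: "?q (r *\<^sub>R y) \<le> r * ?q y" if r: "0 < r" for r y
  proof -
    have "?q (r *\<^sub>R y) / r \<le> p (y + t *\<^sub>R b) - t * p b" if "0 \<le> t" for t
      using directional_relaxation_le[of "r * t" b "r *\<^sub>R y"] that r
        sublinear_scaleR[OF p, of r "y + t *\<^sub>R b"]
      by (simp add: field_simps)
    then have "?q (r *\<^sub>R y) / r \<le> ?q y"
      by (rule directional_relaxation_greatest)
    then show ?thesis using r by (simp add: field_simps)
  qed
  have "?q (r *\<^sub>R y) = r * ?q y" if r: "0 \<le> r" for r y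
  proof (cases "r = 0")
    case True
    have "?q 0 = 0"
      by (simp add: directional_relaxation_def sublinear_scaleR[OF p])
    with True show ?thesis by simp
  next
    case False
    then have "r * ?q y \<le> ?q (r *\<^sub>R y)"
      using le[of "1 / r" "r *\<^sub>R y"] r by (simp add: field_simps)
    with le[of r y] r False show ?thesis by simp
  qed
  with add show ?thesis by (simp add: sublinear_def)
qed

end

text \<open>
  Without the chain condition the infimum of sublinear functionals need not be subadditive; for a
  chain, two members that nearly attain the infimum at \<open>y\<close> and at \<open>z\<close> can be replaced by the
  smaller one.
\<close>

lemma sublinear_INF_chain:
  assumes "C \<noteq> {}" and sub: "\<And>q. q \<in> C \<Longrightarrow> sublinear q"
    and bdd: "\<And>y. bdd_below ((\<lambda>q. q y) ` C)"
    and chain: "\<And>q r. q \<in> C \<Longrightarrow> r \<in> C \<Longrightarrow> q \<le> r \<or> r \<le> q"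
  shows "sublinear (\<lambda>y. INF q\<in>C. q y)"
proof -
  let ?u = "\<lambda>y. INF q\<in>C. q y"
  have lower: "?u y \<le> q y" if "q \<in> C" for q y
    by (rule cINF_lower[OF bdd that])
  have greatest: "c \<le> ?u y" if "\<And>q. q \<in> C \<Longrightarrow> c \<le> q y" for c y
    by (rule cINF_greatest[OF \<open>C \<noteq> {}\<close> that])
  have "?u (y + z) \<le> ?u y + ?u z" for y z
  proof -
    have "?u (y + z) \<le> q y + r z" if qr: "q \<in> C" "r \<in> C" for q r
    proof -
      obtain s where s: "s \<in> C" "s \<le> q" "s \<le> r"
        using chain[OF qr] qr by auto
      have "?u (y + z) \<le> s (y + z)" by (rule lower[OF s(1)])
      also have "\<dots> \<le> s y + s z" by (rule sublinear_add[OF sub[OF s(1)]])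
      also have "\<dots> \<le> q y + r z" using s by (intro add_mono) (auto simp: le_fun_def)
      finally show ?thesis .
    qed
    then have "?u (y + z) - r z \<le> ?u y" if "r \<in> C" for r
      using that by (intro greatest) (simp add: algebra_simps)
    then have "?u (y + z) - ?u y \<le> ?u z"
      by (intro greatest) (simp add: algebra_simps)
    then show ?thesis by simp
  qed
  moreover have "?u (t *\<^sub>R y) = t * ?u y" if t: "0 \<le> t" for t y
  proof (cases "t = 0")
    case True
    have "(\<lambda>q. q 0) ` C = (\<lambda>q. 0) ` C"
      using sublinear_scaleR[OF sub, of _ 0 0] by (intro image_cong) auto
    then show ?thesis using True \<open>C \<noteq> {}\<close> by (simp add: image_constant_conv)
  next
    case False
    with t have pos: "0 < t" by simp
    have "?u (t *\<^sub>R y) / t \<le> ?u y"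
      using lower[of _ "t *\<^sub>R y"] pos sublinear_scaleR[OF sub t]
      by (intro greatest) (simp add: field_simps)
    moreover have "t * ?u y \<le> ?u (t *\<^sub>R y)"
    proof (rule greatest)
      fix q assume "q \<in> C"
      then have "t * ?u y \<le> t * q y" by (intro mult_left_mono lower t)
      then show "t * ?u y \<le> q (t *\<^sub>R y)" by (simp add: sublinear_scaleR[OF sub t] \<open>q \<in> C\<close>)
    qed
    ultimately show ?thesis using pos by (simp add: field_simps)
  qed
  ultimately show ?thesis by (simp add: sublinear_def)
qed

text \<open>
  Zorn's lemma applies because \<open>- p (- y) \<le> - q (- y) \<le> q y\<close> for every sublinear \<open>q \<le> p\<close>, which
  bounds all such \<open>q\<close> from below and makes the infimum of a chain finite.
\<close>

lemma exists_minimal_sublinear: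
  assumes p: "sublinear p"
  obtains u where "sublinear u" "u \<le> p" "\<And>q. sublinear q \<Longrightarrow> q \<le> u \<Longrightarrow> q = u"
proof -
  let ?A = "{q. sublinear q \<and> q \<le> p}"
  have "\<exists>u\<in>?A. \<forall>q\<in>?A. q \<le> u \<longrightarrow> q = u"
  proof (rule predicate_Zorn)
    show "partial_order_on ?A (relation_of (\<lambda>q r. r \<le> q) ?A)"
      by (rule partial_order_on_relation_ofI) auto
  next
    fix C assume C: "C \<in> Chains (relation_of (\<lambda>q r. r \<le> q) ?A)"
    have CA: "C \<subseteq> ?A" by (rule Chains_relation_of[OF C])
    have chain: "q \<le> r \<or> r \<le> q" if "q \<in> C" "r \<in> C" for q r
      using C that by (auto simp: Chains_def relation_of_def)
    show "\<exists>u\<in>?A. \<forall>q\<in>C. u \<le> q"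
    proof (cases "C = {}")
      case True
      with p show ?thesis by auto
    next
      case False
      have bdd: "bdd_below ((\<lambda>q. q y) ` C)" for y
      proof (rule bdd_belowI2)
        fix q assume "q \<in> C"
        then have q: "sublinear q" "q (- y) \<le> p (- y)" using CA by (auto simp: le_fun_def)
        then show "- p (- y) \<le> q y" using sublinear_minus[OF q(1), of y] by linarith
      qed
      let ?u = "\<lambda>y. INF q\<in>C. q y"
      have sub: "sublinear ?u"
        by (rule sublinear_INF_chain[OF False _ bdd chain]) (use CA in auto)
      have below: "?u \<le> q" if "q \<in> C" for q
        using cINF_lower[OF bdd that] by (simp add: le_fun_def)
      obtain q where "q \<in> C" using False by blast
      then have "?u \<le> p" using below[of q] CA order_trans by blast
      with sub below show ?thesis by auto
    qed
  qed
  then show thesis using that order_trans by blast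
qed

text \<open>
  A minimal functional coincides with its relaxation along every \<open>y\<close>, hence is odd; subadditivity
  of an odd functional is additivity.
\<close>

lemma minimal_sublinear_linear:
  assumes u: "sublinear u" and min: "\<And>q. sublinear q \<Longrightarrow> q \<le> u \<Longrightarrow> q = u"
  shows "linear u"
proof -
  have uminus: "u (- y) = - u y" for y
  proof -
    have "directional_relaxation u y = u"
      by (intro min sublinear_directional_relaxation directional_relaxation_below u)
    then have "u (- y) \<le> - u y"
      using directional_relaxation_uminus[OF u, of y] by simp
    with sublinear_minus[OF u, of y] show ?thesis by linarith
  qed
  show ?thesis
  proof
    fix y z
    show "u (y + z) = u y + u z"
      using sublinear_add[OF u, of y z] sublinear_add[OF u, of "y + z" "- z"] uminus[of z] by simp
  next
    fix t y
    show "u (t *\<^sub>R y) = t *\<^sub>R u y"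
    proof (cases "0 \<le> t")
      case True
      then show ?thesis by (simp add: sublinear_scaleR[OF u])
    next
      case False
      then show ?thesis
        using sublinear_scaleR[OF u, of "- t" y] uminus[of "t *\<^sub>R y"] by simp
    qed
  qed
qed

text \<open>
  Relaxing along \<open>x\<close> before minimising pins down the value at \<open>x\<close>: everything below the relaxation
  takes a value of at most \<open>- p x\<close> at \<open>- x\<close>, so a linear such functional takes at least \<open>p x\<close> at \<open>x\<close>.
\<close>

theorem sublinear_Hahn_Banach:
  fixes p :: "'a::real_vector \<Rightarrow> real"
  assumes p: "sublinear p"
  obtains u where "linear u" "\<And>y. u y \<le> p y" "u x = p x"
proof -
  obtain u where u: "sublinear u" "u \<le> directional_relaxation p x"
    and min: "\<And>q. sublinear q \<Longrightarrow> q \<le> u \<Longrightarrow> q = u"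
    using exists_minimal_sublinear[OF sublinear_directional_relaxation[OF p]] by blast
  have lin: "linear u" by (rule minimal_sublinear_linear[OF u(1) min])
  have "u \<le> p" using u(2) directional_relaxation_below[OF p] by (rule order_trans)
  then have le: "u y \<le> p y" for y by (simp add: le_fun_def)
  have "u (- x) \<le> directional_relaxation p x (- x)" using u(2) by (simp add: le_fun_def)
  also have "\<dots> \<le> - p x" by (rule directional_relaxation_uminus[OF p])
  finally have "p x \<le> u x" using linear_neg[OF lin, of x] by simp
  with le[of x] have "u x = p x" by simp
  with lin le show thesis by (rule that)
qed

section \<open>Support functionals of seminorms over the scalar field\<close>

text \<open>
  Moving the multiples of \<open>i\<close> to one side and squaring equates \<open>- ((b - d)\<^sup>2)\<close> with \<open>(c - a)\<^sup>2\<close>.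
\<close>

lemma imaginary_unit_independent:
  fixes i :: "'k::real_normed_field"
  assumes "i * i = - 1" and eq: "of_real a + i * of_real b = of_real c + i * of_real d"
  shows "a = c \<and> b = d"
proof -
  have "i * of_real (b - d) = of_real (c - a)"
    using eq by (simp add: algebra_simps)
  then have "(i * i) * of_real ((b - d)\<^sup>2) = (of_real ((c - a)\<^sup>2) :: 'k)"
    by (simp add: power2_eq_square) (metis mult.assoc mult.commute)
  then have "of_real (- ((b - d)\<^sup>2)) = (of_real ((c - a)\<^sup>2) :: 'k)"
    using assms(1) by simp
  then have "- ((b - d)\<^sup>2) = (c - a)\<^sup>2" using of_real_eq_iff by blast
  then have "(b - d)\<^sup>2 + (c - a)\<^sup>2 = 0" by linarith
  then show ?thesis by (simp add: sum_power2_eq_zero_iff)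
qed

context banach_space_over
begin

lemma scale_scaleR: "scl c (r *\<^sub>R y) = r *\<^sub>R scl c y"
  by (metis scale_of_real scale_scale mult.commute)

text \<open>
  A complex-linear functional is determined by its real part \<open>u\<close>, its imaginary part at \<open>y\<close> being
  \<open>- u (i y)\<close>.
\<close>

lemma complexified_functional:
  fixes i :: 'k and u :: "'a \<Rightarrow> real"
  assumes i: "i * i = - 1" and rep: "\<And>z::'k. \<exists>a b. z = of_real a + of_real b * i"
    and u: "linear u"
  shows "Vector_Spaces.linear scl (*) (\<lambda>y. of_real (u y) - i * of_real (u (scl i y)))"
proof -
  interpret u: linear u by (rule u)
  show ?thesis
  proof (unfold_locales)
    fix c y
    obtain a b where c: "c = of_real a + of_real b * i" using rep by blast
    have "scl c y = a *\<^sub>R y + b *\<^sub>R scl i y"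
      by (simp add: c scale_left_distrib scale_of_real flip: scale_scale)
    moreover have "scl i (scl i y) = - y" by (simp add: i)
    ultimately have 1: "u (scl c y) = a * u y + b * u (scl i y)"
      and 2: "u (scl i (scl c y)) = a * u (scl i y) - b * u y"
      by (simp_all add: scale_right_distrib scale_scaleR u.add u.diff u.scaleR u.neg)
    have ii: "i * (i * w) = - w" for w by (simp add: i flip: mult.assoc)
    show "of_real (u (scl c y)) - i * of_real (u (scl i (scl c y)))
        = c * (of_real (u y) - i * of_real (u (scl i y)))"
      unfolding 1 2 by (simp add: c ii algebra_simps)
  qed (auto simp: scale_right_distrib u.add algebra_simps)
qed

text \<open>
  A seminorm is in particular sublinear over the reals, so some real-linear \<open>u \<le> q\<close> agrees with \<open>q\<close>
  at \<open>x\<close>.  Over the reals \<open>u\<close> is the required functional; over the complex numbers it is the real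
  part of one.  There the bound \<open>norm (g x) \<le> q x\<close>, together with the real part being \<open>q x\<close>, leaves
  no room for an imaginary part at \<open>x\<close>.
\<close>

theorem seminorm_Hahn_Banach:
  fixes q :: "'a \<Rightarrow> real"
  assumes add: "\<And>y z. q (y + z) \<le> q y + q z" and scale: "\<And>c y. q (scl c y) = norm c * q y"
  obtains g where "Vector_Spaces.linear scl (*) g" "\<And>y. norm (g y) \<le> q y" "g x = of_real (q x)"
proof -
  have scaleR: "q (t *\<^sub>R y) = \<bar>t\<bar> * q y" for t y
    using scale[of "of_real t" y] by (simp add: scale_of_real)
  then have "sublinear q" by (simp add: sublinear_def add)
  from sublinear_Hahn_Banach[OF this, of x]
  obtain u where u: "linear u" and le: "\<And>y. u y \<le> q y" and x: "u x = q x"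
    by metis
  interpret u: linear u by (rule u)
  have abs_le: "\<bar>u y\<bar> \<le> q y" for y
    using le[of y] le[of "- y"] scaleR[of "- 1" y] by (simp add: u.neg abs_le_iff)
  consider (real) "\<forall>z::'k. \<exists>a. z = a *\<^sub>R 1"
    | (complex) i :: 'k where "i * i = - 1"
      "\<forall>z. \<exists>a b. z = a *\<^sub>R 1 + b *\<^sub>R i \<and> norm z = sqrt (a\<^sup>2 + b\<^sup>2)"
    using real_or_complex[where 'a = 'k] by blast
  then show thesis
  proof cases
    case real
    show thesis
    proof (rule that[of "\<lambda>y. of_real (u y)"])
      show "Vector_Spaces.linear scl (*) (\<lambda>y. of_real (u y) :: 'k)"
      proof (unfold_locales)
        fix c :: 'k and y :: 'a
        obtain a where "c = of_real a" using real unfolding of_real_def by blast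
        then show "of_real (u (scl c y)) = c * (of_real (u y) :: 'k)"
          by (simp add: scale_of_real u.scaleR)
      qed (auto simp: u.add algebra_simps)
    qed (use abs_le x in auto)
  next
    case complex
    let ?g = "\<lambda>y. of_real (u y) - i * of_real (u (scl i y))"
    have norm_rep: "\<exists>a b. z = of_real a + of_real b * i \<and> norm z = sqrt (a\<^sup>2 + b\<^sup>2)" for z
      using complex(2) by (simp add: scaleR_conv_of_real)
    have g: "Vector_Spaces.linear scl (*) ?g"
      by (rule complexified_functional[OF complex(1) _ u]) (use norm_rep in blast)
    interpret g: Vector_Spaces.linear scl "(*)" ?g by (rule g)
    have bound: "norm (?g y) \<le> q y" for y
    proof (cases "?g y = 0")
      case True
      then show ?thesis using abs_le[of y] by simp
    next
      case False
      (* Rotating y by a unimodular scalar makes the value of the functional real and positive. *)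
      define c where "c = of_real (norm (?g y)) / ?g y"
      have "norm c = 1" using False by (simp add: c_def norm_divide)
      have "?g (scl c y) = of_real (norm (?g y))" using False by (simp only: g.scale) (simp add: c_def)
      then have "of_real (u (scl c y)) + i * of_real (- u (scl i (scl c y)))
          = of_real (norm (?g y)) + i * of_real 0"
        by simp
      from imaginary_unit_independent[OF complex(1) this]
      have "norm (?g y) = u (scl c y)" by simp
      also have "\<dots> \<le> q (scl c y)" by (rule le)
      finally show ?thesis by (simp add: scale \<open>norm c = 1\<close>)
    qed
    have "?g x = of_real (q x)"
    proof -
      obtain a b where ab: "?g x = of_real a + of_real b * i" "norm (?g x) = sqrt (a\<^sup>2 + b\<^sup>2)"
        using norm_rep by blast
      have "of_real (u x) + i * of_real (- u (scl i x)) = of_real a + i * of_real b"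
        using ab(1) by (simp add: mult.commute)
      from imaginary_unit_independent[OF complex(1) this] have "a = q x" by (simp add: x)
      have "sqrt (a\<^sup>2 + b\<^sup>2) \<le> a" using bound[of x] ab(2) \<open>a = q x\<close> by simp
      then have "a\<^sup>2 + b\<^sup>2 \<le> a\<^sup>2" by (rule sqrt_le_D)
      then have "b = 0" by simp
      with ab(1) \<open>a = q x\<close> show ?thesis by simp
    qed
    with g bound show thesis by (intro that[of ?g])
  qed
qed

section \<open>Orthogonality and support functionals\<close>

lemma dual_space_norm_le:
  assumes "f \<in> dual_space scl"
  shows "norm (f y) \<le> onorm f * norm y"
  using assms onorm by (auto simp: dual_space_def bounded_linear_over_def)

lemma dual_spaceI:
  assumes g: "Vector_Spaces.linear scl (*) g" and le: "\<And>y. norm (g y) \<le> norm y"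
  shows "g \<in> dual_space scl"
proof -
  interpret g: Vector_Spaces.linear scl "(*)" g by (rule g)
  have "bounded_linear g"
  proof (rule bounded_linear_intro)
    show "g (r *\<^sub>R y) = r *\<^sub>R g y" for r y
      using g.scale[of "of_real r" y] by (simp add: scale_of_real scaleR_conv_of_real)
    show "norm (g y) \<le> norm y * 1" for y using le by simp
  qed (rule g.add)
  then show ?thesis by (simp add: dual_space_def bounded_linear_over_def g)
qed

lemma support_functional_kernel_orthogonal:
  assumes f: "f \<in> support_functionals scl x" and "f y = 0"
  shows "birkhoff_james_orthogonal scl x y"
  unfolding birkhoff_james_orthogonal_def
proof
  fix c
  have dual: "f \<in> dual_space scl" and "onorm f = 1" and fx: "f x = of_real (norm x)"
    using f by (auto simp: support_functionals_def)
  interpret f: Vector_Spaces.linear scl "(*)" f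
    using dual by (simp add: dual_space_def bounded_linear_over_def)
  have "norm x = norm (f (x + scl c y))" by (simp add: f.add f.scale \<open>f y = 0\<close> fx)
  also have "\<dots> \<le> norm (x + scl c y)"
    using dual_space_norm_le[OF dual, of "x + scl c y"] \<open>onorm f = 1\<close> by simp
  finally show "norm x \<le> norm (x + scl c y)" .
qed

lemma infdist_greatest:
  fixes M :: "'x::metric_space set"
  assumes "M \<noteq> {}" "\<And>a. a \<in> M \<Longrightarrow> c \<le> dist y a"
  shows "c \<le> infdist y M"
  using assms by (simp add: infdist_notempty cINF_greatest)

lemma infdist_subspace_add:
  assumes M: "subspace M"
  shows "infdist (y + z) M \<le> infdist y M + infdist z M"
proof -
  have ne: "M \<noteq> {}" using subspace_0[OF M] by auto
  have "infdist (y + z) M \<le> dist y a + dist z b" if "a \<in> M" "b \<in> M" for a b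
    using infdist_le[OF subspace_add[OF M that], of "y + z"] norm_diff_triangle_ineq[of y z a b]
    by (simp add: dist_norm)
  then have "infdist (y + z) M - dist z b \<le> infdist y M" if "b \<in> M" for b
    using that ne by (intro infdist_greatest) (auto simp: algebra_simps)
  then have "infdist (y + z) M - infdist y M \<le> infdist z M"
    using ne by (intro infdist_greatest) (auto simp: algebra_simps)
  then show ?thesis by simp
qed

lemma infdist_subspace_scale:
  assumes M: "subspace M"
  shows "infdist (scl c y) M = norm c * infdist y M"
proof -
  have ne: "M \<noteq> {}" using subspace_0[OF M] by auto
  have le: "infdist (scl c y) M \<le> norm c * infdist y M" if "c \<noteq> 0" for c y
  proof -
    have "infdist (scl c y) M / norm c \<le> dist y a" if "a \<in> M" for a
    proof -
      have "infdist (scl c y) M \<le> dist (scl c y) (scl c a)"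
        by (intro infdist_le subspace_scale M that)
      also have "\<dots> = norm c * dist y a"
        by (simp add: dist_norm norm_scale flip: scale_right_diff_distrib)
      finally show ?thesis using \<open>c \<noteq> 0\<close> by (simp add: field_simps)
    qed
    then have "infdist (scl c y) M / norm c \<le> infdist y M"
      using ne by (intro infdist_greatest)
    then show ?thesis using \<open>c \<noteq> 0\<close> by (simp add: field_simps)
  qed
  show ?thesis
  proof (cases "c = 0")
    case True
    then show ?thesis using subspace_0[OF M] by simp
  next
    case False
    have "norm c * infdist y M \<le> infdist (scl c y) M"
      using le[of "inverse c" "scl c y"] False by (simp add: norm_divide field_simps)
    with le[OF False, of y] show ?thesis by simp
  qed
qed

text \<open>
  The functional comes from the Hahn--Banach theorem for the seminorm \<open>y \<mapsto> infdist y M\<close>.  This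
  seminorm is at most the norm, which bounds the functional by \<open>1\<close>; it is zero on \<open>M\<close>, which makes
  the functional vanish there; and by orthogonality it equals the norm at \<open>x\<close>.
\<close>

lemma support_functional_vanishing_on_orthogonal_subspace:
  assumes M: "subspace M" and orth: "\<And>y. y \<in> M \<Longrightarrow> birkhoff_james_orthogonal scl x y"
    and "x \<noteq> 0"
  obtains g where "g \<in> support_functionals scl x" "\<And>y. y \<in> M \<Longrightarrow> g y = 0"
proof -
  have "0 \<in> M" by (rule subspace_0[OF M])
  have dist_x: "infdist x M = norm x"
  proof (rule antisym)
    show "infdist x M \<le> norm x" using infdist_le[OF \<open>0 \<in> M\<close>, of x] by simp
    have "norm x \<le> dist x y" if "y \<in> M" for y
      using orth[OF that] unfolding birkhoff_james_orthogonal_def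
      by (auto dest!: spec[of _ "- 1"] simp: dist_norm)
    then show "norm x \<le> infdist x M"
      using \<open>0 \<in> M\<close> by (intro infdist_greatest) auto
  qed
  obtain g where g: "Vector_Spaces.linear scl (*) g" and le: "\<And>y. norm (g y) \<le> infdist y M"
    and gx: "g x = of_real (infdist x M)"
    using seminorm_Hahn_Banach[of "\<lambda>y. infdist y M" x]
      infdist_subspace_add[OF M] infdist_subspace_scale[OF M] by blast
  have le_norm: "norm (g y) \<le> norm y" for y
    using le[of y] infdist_le[OF \<open>0 \<in> M\<close>, of y] by simp
  have dual: "g \<in> dual_space scl" by (rule dual_spaceI[OF g le_norm])
  have "onorm g \<le> 1" by (rule onorm_bound) (use le_norm in auto)
  moreover have "1 \<le> onorm g"
    using dual_space_norm_le[OF dual, of x] gx dist_x \<open>x \<noteq> 0\<close> by simp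
  ultimately have "g \<in> support_functionals scl x"
    using dual gx dist_x by (simp add: support_functionals_def)
  moreover have "g y = 0" if "y \<in> M" for y
    using le[of y] that by simp
  ultimately show thesis by (rule that)
qed

end

section \<open>Spaces of functionals\<close>

lemma sum_fun_apply: "(\<Sum>b\<in>B. h b) y = (\<Sum>b\<in>B. h b y)"
  by (induction B rule: infinite_finite_induct) auto

text \<open>
  A linear functional is the combination of the coordinate functions of a finite basis, with its
  values on the basis as coefficients.
\<close>

lemma functionals_finitely_spanned:
  assumes X: "banach_space_over scl" and fin: "has_dimension scl UNIV m"
  shows "\<exists>D. finite D \<and> dual_space scl \<subseteq> module.span scale_fun D"
proof -
  interpret X: banach_space_over scl by (rule X)
  interpret F: vector_space "scale_fun :: _ \<Rightarrow> ('b \<Rightarrow> 'a) \<Rightarrow> _" by (rule vector_space_scale_fun)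
  obtain S where S: "finite S" "UNIV \<subseteq> X.span S" using fin by (auto simp: has_dimension_def)
  obtain B where B: "B \<subseteq> S" "X.independent B" "S \<subseteq> X.span B"
    using X.maximal_independent_subset by blast
  have "finite B" using B(1) S(1) by (rule finite_subset)
  have "X.span B = UNIV" using S(2) X.span_minimal[OF B(3) X.subspace_span] by auto
  let ?coord = "\<lambda>b y. X.representation B y b"
  have "f \<in> F.span (?coord ` B)" if "f \<in> dual_space scl" for f
  proof -
    interpret f: Vector_Spaces.linear scl "(*)" f
      using that by (simp add: dual_space_def bounded_linear_over_def)
    have "f y = (\<Sum>b\<in>B. scale_fun (f b) (?coord b)) y" for y
    proof -
      have "f y = f (\<Sum>b\<in>B. scl (?coord b y) b)"
        using X.sum_representation_eq[OF B(2) _ \<open>finite B\<close> order_refl] \<open>X.span B = UNIV\<close> by simp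
      also have "\<dots> = (\<Sum>b\<in>B. ?coord b y * f b)" by (simp add: f.sum f.scale)
      finally show ?thesis by (simp add: sum_fun_apply scale_fun_def mult.commute)
    qed
    then have "f = (\<Sum>b\<in>B. scale_fun (f b) (?coord b))" by blast
    also have "\<dots> \<in> F.span (?coord ` B)"
      by (intro F.span_sum F.span_scale F.span_base) auto
    finally show ?thesis .
  qed
  then show ?thesis using \<open>finite B\<close> by blast
qed

lemma span_support_functionals_finitely_spanned:
  assumes "banach_space_over scl" "has_dimension scl UNIV m"
  obtains D where "finite D"
    "module.span scale_fun (support_functionals scl y) \<subseteq> module.span scale_fun D"
proof -
  interpret F: vector_space "scale_fun :: _ \<Rightarrow> ('b \<Rightarrow> 'a) \<Rightarrow> _" by (rule vector_space_scale_fun)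
  obtain D where D: "finite D" "dual_space scl \<subseteq> F.span D"
    using functionals_finitely_spanned[OF assms] by blast
  have "support_functionals scl y \<subseteq> F.span D"
    using D(2) by (auto simp: support_functionals_def)
  then have "F.span (support_functionals scl y) \<subseteq> F.span D"
    by (intro F.span_minimal F.subspace_span)
  with D(1) show thesis by (rule that)
qed

lemma dim_pullback_le:
  fixes T :: "'a \<Rightarrow> 'b" and F G :: "(_ \<Rightarrow> 'k::field) set"
  assumes sub: "F \<subseteq> (\<lambda>g. g \<circ> T) ` module.span scale_fun G"
    and fin: "finite D" "module.span scale_fun G \<subseteq> module.span scale_fun D"
  shows "vector_space.dim scale_fun (module.span scale_fun F)
    \<le> vector_space.dim scale_fun (module.span scale_fun G)"
proof -
  interpret X: vector_space "scale_fun :: _ \<Rightarrow> ('a \<Rightarrow> 'k) \<Rightarrow> _" by (rule vector_space_scale_fun)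
  interpret Y: vector_space "scale_fun :: _ \<Rightarrow> ('b \<Rightarrow> 'k) \<Rightarrow> _" by (rule vector_space_scale_fun)
  let ?P = "\<lambda>g::'b \<Rightarrow> 'k. g \<circ> T"
  interpret P: Vector_Spaces.linear scale_fun scale_fun ?P
    by unfold_locales (auto simp: scale_fun_def fun_eq_iff)
  obtain C where C: "C \<subseteq> Y.span G" "Y.independent C" "Y.span G \<subseteq> Y.span C"
    "card C = Y.dim (Y.span G)"
    using Y.basis_exists by blast
  have "finite C" using Y.independent_span_bound[OF fin(1) C(2)] C(1) fin(2) by blast
  have "F \<subseteq> X.span (?P ` C)"
    using sub C(3) by (auto simp: P.span_image)
  then have "X.span F \<subseteq> X.span (?P ` C)"
    by (intro X.span_minimal X.subspace_span)
  then have "X.dim (X.span F) \<le> card (?P ` C)"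
    by (rule X.dim_le_card) (simp add: \<open>finite C\<close>)
  also have "\<dots> \<le> card C" using \<open>finite C\<close> by (rule card_image_le)
  finally show ?thesis by (simp add: C(4))
qed

text \<open>
  The functional \<open>g\<close> obtained from the orthogonality of \<open>T x\<close> to the image of the kernel of \<open>f\<close> is
  such that \<open>g \<circ> T\<close> and \<open>f\<close> have proportional values; comparing them at \<open>x\<close> gives the factor
  \<open>\<parallel>x\<parallel> / \<parallel>T x\<parallel>\<close>.
\<close>

lemma support_functionals_subset_pullback:
  assumes X: "banach_space_over scaleX" and Y: "banach_space_over scaleY"
    and T: "Vector_Spaces.linear scaleX scaleY T" and "x \<noteq> 0" "T x \<noteq> 0"
    and pres: "preserves_orthogonality_at scaleX scaleY T x"
  shows "support_functionals scaleX x
    \<subseteq> (\<lambda>g. g \<circ> T) ` module.span scale_fun (support_functionals scaleY (T x))"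
proof
  interpret X: banach_space_over scaleX by (rule X)
  interpret Y: banach_space_over scaleY by (rule Y)
  interpret T: Vector_Spaces.linear scaleX scaleY T by (rule T)
  interpret F: vector_space "scale_fun :: _ \<Rightarrow> ('c \<Rightarrow> 'a) \<Rightarrow> _" by (rule vector_space_scale_fun)
  fix f assume f: "f \<in> support_functionals scaleX x"
  then have fx: "f x = of_real (norm x)" by (simp add: support_functionals_def)
  interpret f: Vector_Spaces.linear scaleX "(*)" f
    using f by (simp add: support_functionals_def dual_space_def bounded_linear_over_def)
  have "Y.subspace (T ` {y. f y = 0})"
    by (intro T.subspace_image f.subspace_kernel)
  moreover have "birkhoff_james_orthogonal scaleY (T x) z" if "z \<in> T ` {y. f y = 0}" for z
    using that pres X.support_functional_kernel_orthogonal[OF f]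
    by (auto simp: preserves_orthogonality_at_def)
  ultimately obtain g where g: "g \<in> support_functionals scaleY (T x)"
    and zero: "\<And>z. z \<in> T ` {y. f y = 0} \<Longrightarrow> g z = 0"
    using Y.support_functional_vanishing_on_orthogonal_subspace \<open>T x \<noteq> 0\<close> by metis
  then have gx: "g (T x) = of_real (norm (T x))" by (simp add: support_functionals_def)
  interpret g: Vector_Spaces.linear scaleY "(*)" g
    using g by (simp add: support_functionals_def dual_space_def bounded_linear_over_def)
  let ?c = "of_real (norm x / norm (T x)) :: 'a"
  have "f y = ?c * g (T y)" for y
  proof -
    \<comment> \<open>Subtracting a multiple of \<open>x\<close> moves \<open>y\<close> into the kernel of \<open>f\<close>.\<close>
    let ?z = "y - scaleX (f y / f x) x"
    have "f ?z = 0" using fx \<open>x \<noteq> 0\<close> by (simp add: f.diff f.scale)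
    then have "g (T ?z) = 0" using zero by blast
    then have "g (T y) = f y / f x * g (T x)" by (simp add: T.diff T.scale g.diff g.scale)
    then show ?thesis using \<open>x \<noteq> 0\<close> \<open>T x \<noteq> 0\<close> by (simp add: fx gx field_simps)
  qed
  then have "f = scale_fun ?c g \<circ> T" by (simp add: fun_eq_iff scale_fun_def)
  moreover have "scale_fun ?c g \<in> F.span (support_functionals scaleY (T x))"
    by (intro F.span_scale F.span_base g)
  ultimately show "f \<in> (\<lambda>g. g \<circ> T) ` F.span (support_functionals scaleY (T x))" by blast
qed

theorem theorem2p9:
  fixes scaleX :: "'k::real_or_complex_field \<Rightarrow> 'a::banach \<Rightarrow> 'a"
    and scaleY :: "'k \<Rightarrow> 'b::banach \<Rightarrow> 'b"
    and T :: "'a \<Rightarrow> 'b" and x :: 'a and n m k :: nat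
  assumes "banach_space_over scaleX" and "has_dimension scaleX UNIV n"
    and "banach_space_over scaleY" and "has_dimension scaleY UNIV m"
    and "bounded_linear_over scaleX scaleY T"
    and "smooth_point scaleX k x"
    and "preserves_orthogonality_at scaleX scaleY T x"
  shows "T x = 0 \<or> (\<exists>p. k \<le> p \<and> smooth_point scaleY p (T x))"
proof (cases "T x = 0")
  case True
  then show ?thesis ..
next
  case False
  let ?JX = "support_functionals scaleX x" and ?JY = "support_functionals scaleY (T x)"
  let ?p = "vector_space.dim scale_fun (module.span scale_fun ?JY)"
  obtain D where D: "finite D" "module.span scale_fun ?JY \<subseteq> module.span scale_fun D"
    using span_support_functionals_finitely_spanned[OF assms(3,4)] by blast
  have "x \<noteq> 0" and k: "k = vector_space.dim scale_fun (module.span scale_fun ?JX)"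
    using assms(6) by (auto simp: smooth_point_def has_dimension_def)
  have "?JX \<subseteq> (\<lambda>g. g \<circ> T) ` module.span scale_fun ?JY"
    using assms(5,7) \<open>x \<noteq> 0\<close> False
    by (intro support_functionals_subset_pullback[OF assms(1,3)]) (auto simp: bounded_linear_over_def)
  then have "k \<le> ?p" unfolding k by (rule dim_pullback_le[OF _ D])
  moreover have "smooth_point scaleY ?p (T x)"
    using False D by (auto simp: smooth_point_def has_dimension_def)
  ultimately show ?thesis by blast
qed

end
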